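(* Let $A$ be a finite abelian group, $N$ a group acting on $A$ from the right by group automorphisms, $(a,u)\mapsto a\triangleleft u$, and let $G=A\rtimes N$ be the semidirect product in which $u a u^{-1}=a\triangleleft u^{-1}$ for $a\in A$, $u\in N$ (i.e. $(A,N)$ is a matched pair with $A$ acting trivially on $N$). Let $k$ be a field with $\mathrm{char}(k)\nmid |A|$ containing all $|A|$-th roots of unity, and let $A^\vee=\mathrm{Hom}(A,k^* )$. For $\chi\in A^\vee$ put $e_\chi=\frac1{|A|}\sum_{a\in A}\chi(a^{-1})\,a\in k[A]$. Then the basis $\mathcal B_{A^\vee}=\{e_\chi u\mid \chi\in A^\vee,\ u\in N\}$ of $k[G]$ is $\Phi$-set theoretic. Moreover, identifying $e_\chi u$ with $(\chi,u)$, the map $\Phi_{k[G]}$ restricts to the following set-theoretic solution of the reversed pentagon equation: $$\phi_{A^\vee\bowtie N}:(A^\vee\times N)\times(A^\vee\times N)\to(A^\vee\times N)\times(A^\vee\times N),$$ $$\phi_{A^\vee\bowtie N}\bigl((\alpha,u),(\beta,v)\bigr)=\bigl((\alpha(u\cdot\beta)^{-1},u),\ (u\cdot\beta,uv)\bigr),$$ where $(u\cdot\chi)(a)=\chi(a\triangleleft u)=\chi(u^{-1}au)$ is the induced left action of $N$ on $A^\vee$.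
   Context: For the group algebra $k[G]$ (with $\Delta(g)=g\otimes g$ for $g\in G$), $\Phi_{k[G]}(x\otimes y)=x_{(1)}\otimes x_{(2)}y$, i.e. the linear extension of $g\otimes h\mapsto g\otimes gh$. A basis $\mathcal B$ of $k[G]$ is $\Phi$-set theoretic if for all $b,c\in\mathcal B$ there are $b',c'\in\mathcal B$ with $\Phi_{k[G]}(b\otimes c)=b'\otimes c'$. A set-theoretic solution of the reversed pentagon equation on a set $T$ is a map $s:T\times T\to T\times T$ with $s_{12}s_{13}s_{23}=s_{23}s_{12}$ on $T^3$, where $s_{ij}$ acts on the $i$-th and $j$-th coordinates. *)

theory Defs
  imports "HOL-Library.Poly_Mapping" "HOL-Algebra.Algebraic_Closure_Type"
begin

section \<open>Finitely supported functions as a vector space\<close>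

definition pm_scale :: "'k::field \<Rightarrow> ('g \<Rightarrow>\<^sub>0 'k) \<Rightarrow> ('g \<Rightarrow>\<^sub>0 'k)" where
  "pm_scale c x = Poly_Mapping.map ((*) c) x"

lemma lookup_pm_scale [simp]:
  "Poly_Mapping.lookup (pm_scale c x) g = c * Poly_Mapping.lookup x g"
  by (simp add: pm_scale_def Poly_Mapping.map.rep_eq when_def)

global_interpretation pm: vector_space "pm_scale :: 'k::field \<Rightarrow> ('g \<Rightarrow>\<^sub>0 'k) \<Rightarrow> ('g \<Rightarrow>\<^sub>0 'k)"
  by unfold_locales (auto intro!: poly_mapping_eqI simp: lookup_add algebra_simps)

definition lin_ext :: "('g \<Rightarrow> ('h \<Rightarrow>\<^sub>0 'k::field)) \<Rightarrow> ('g \<Rightarrow>\<^sub>0 'k) \<Rightarrow> ('h \<Rightarrow>\<^sub>0 'k)" where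
  "lin_ext f x = (\<Sum>g\<in>Poly_Mapping.keys x. pm_scale (Poly_Mapping.lookup x g) (f g))"

lemma lin_ext_superset:
  assumes "finite S" "Poly_Mapping.keys x \<subseteq> S"
  shows "lin_ext f x = (\<Sum>g\<in>S. pm_scale (Poly_Mapping.lookup x g) (f g))"
  unfolding lin_ext_def
  by (rule sum.mono_neutral_left) (use assms in \<open>auto simp: in_keys_iff\<close>)

lemma lin_ext_single [simp]: "lin_ext f (Poly_Mapping.single g c) = pm_scale c (f g)"
  by (subst lin_ext_superset[of "{g}"]) auto

lemma lin_ext_add: "lin_ext f (x + y) = lin_ext f x + lin_ext f y"
proof -
  let ?S = "Poly_Mapping.keys x \<union> Poly_Mapping.keys y"
  have "Poly_Mapping.keys (x + y) \<subseteq> ?S" by (rule keys_add)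
  then show ?thesis
    by (simp add: lin_ext_superset[of ?S] lookup_add pm.scale_left_distrib sum.distrib)
qed

lemma lin_ext_scale: "lin_ext f (pm_scale c x) = pm_scale c (lin_ext f x)"
proof -
  have "Poly_Mapping.keys (pm_scale c x) \<subseteq> Poly_Mapping.keys x" by (auto simp: in_keys_iff)
  then show ?thesis
    by (simp add: lin_ext_superset[of "Poly_Mapping.keys x"] pm.scale_sum_right)
qed

lemma lin_ext_sum: "lin_ext f (\<Sum>i\<in>I. x i) = (\<Sum>i\<in>I. lin_ext f (x i))"
  by (induction I rule: infinite_finite_induct) (auto simp: lin_ext_add, simp_all add: lin_ext_def)

lemma lin_ext_lin_ext: "lin_ext f (lin_ext f' z) = lin_ext (\<lambda>g. lin_ext f (f' g)) z"
  by (simp add: lin_ext_def[of f' z] lin_ext_sum lin_ext_scale) (simp add: lin_ext_def[of _ z])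


section \<open>The group algebra and the map \<open>\<Phi>\<close>\<close>

definition group_algebra :: "('g, 'm) monoid_scheme \<Rightarrow> ('g \<Rightarrow>\<^sub>0 'k::field) set" where
  "group_algebra G = {x. Poly_Mapping.keys x \<subseteq> carrier G}"

definition ga_mult ::
    "('g, 'm) monoid_scheme \<Rightarrow> ('g \<Rightarrow>\<^sub>0 'k::field) \<Rightarrow> ('g \<Rightarrow>\<^sub>0 'k) \<Rightarrow> ('g \<Rightarrow>\<^sub>0 'k)" where
  "ga_mult G x y = lin_ext (\<lambda>g. lin_ext (\<lambda>h. Poly_Mapping.single (g \<otimes>\<^bsub>G\<^esub> h) 1) y) x"

definition comult :: "('g \<Rightarrow>\<^sub>0 'k::field) \<Rightarrow> ('g \<times> 'g \<Rightarrow>\<^sub>0 'k)" where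
  "comult = lin_ext (\<lambda>g. Poly_Mapping.single (g, g) 1)"

text \<open>The tensor product of the free modules on \<open>'g\<close> and \<open>'h\<close> is the free module on
  \<open>'g \<times> 'h\<close>, with \<open>g \<otimes> h\<close> represented by the basis vector \<open>(g, h)\<close>.\<close>

definition tensor :: "('g \<Rightarrow>\<^sub>0 'k::field) \<Rightarrow> ('h \<Rightarrow>\<^sub>0 'k) \<Rightarrow> ('g \<times> 'h \<Rightarrow>\<^sub>0 'k)" where
  "tensor x y = lin_ext (\<lambda>g. lin_ext (\<lambda>h. Poly_Mapping.single (g, h) 1) y) x"

definition Phi :: "('g, 'm) monoid_scheme \<Rightarrow> ('g \<times> 'g \<Rightarrow>\<^sub>0 'k::field) \<Rightarrow> ('g \<times> 'g \<Rightarrow>\<^sub>0 'k)" where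
  "Phi G = lin_ext (\<lambda>(g, h). Poly_Mapping.single (g, g \<otimes>\<^bsub>G\<^esub> h) 1)"

lemma lookup_tensor:
  "Poly_Mapping.lookup (tensor x y) (g, h) = Poly_Mapping.lookup x g * Poly_Mapping.lookup y h"
proof -
  have 1: "Poly_Mapping.lookup (lin_ext (\<lambda>h. Poly_Mapping.single (g', h) 1) y) (g, h)
      = (if g' = g then Poly_Mapping.lookup y h else 0)" for g'
    by (auto simp: lin_ext_def lookup_sum lookup_single when_def in_keys_iff sum.delta
        if_distrib cong: if_cong)
  show ?thesis unfolding tensor_def
    by (subst lin_ext_def) (auto simp: lookup_sum 1 in_keys_iff sum.delta if_distrib cong: if_cong)
qed

text \<open>The Sweedler formula \<open>\<Phi>(x \<otimes> y) = x\<^sub>(\<^sub>1\<^sub>) \<otimes> x\<^sub>(\<^sub>2\<^sub>) y\<close>.\<close>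

lemma Phi_tensor:
  "Phi G (tensor x y) =
     lin_ext (\<lambda>(g, h). tensor (Poly_Mapping.single g 1) (ga_mult G (Poly_Mapping.single h 1) y))
       (comult x)"
  by (simp add: Phi_def tensor_def comult_def ga_mult_def lin_ext_lin_ext)

definition basis_of_group_algebra :: "('g, 'm) monoid_scheme \<Rightarrow> ('g \<Rightarrow>\<^sub>0 'k::field) set \<Rightarrow> bool" where
  "basis_of_group_algebra G B \<longleftrightarrow> pm.independent B \<and> pm.span B = group_algebra G"

definition Phi_set_theoretic_basis :: "('g, 'm) monoid_scheme \<Rightarrow> ('g \<Rightarrow>\<^sub>0 'k::field) set \<Rightarrow> bool" where
  "Phi_set_theoretic_basis G B \<longleftrightarrow> basis_of_group_algebra G B \<and>
     (\<forall>b\<in>B. \<forall>c\<in>B. \<exists>b'\<in>B. \<exists>c'\<in>B. Phi G (tensor b c) = tensor b' c')"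


section \<open>Set-theoretic solutions of the reversed pentagon equation\<close>

definition leg12 :: "('t \<times> 't \<Rightarrow> 't \<times> 't) \<Rightarrow> 't \<times> 't \<times> 't \<Rightarrow> 't \<times> 't \<times> 't" where
  "leg12 s = (\<lambda>(x, y, z). let (x', y') = s (x, y) in (x', y', z))"

definition leg13 :: "('t \<times> 't \<Rightarrow> 't \<times> 't) \<Rightarrow> 't \<times> 't \<times> 't \<Rightarrow> 't \<times> 't \<times> 't" where
  "leg13 s = (\<lambda>(x, y, z). let (x', z') = s (x, z) in (x', y, z'))"

definition leg23 :: "('t \<times> 't \<Rightarrow> 't \<times> 't) \<Rightarrow> 't \<times> 't \<times> 't \<Rightarrow> 't \<times> 't \<times> 't" where
  "leg23 s = (\<lambda>(x, y, z). let (y', z') = s (y, z) in (x, y', z'))"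

definition reversed_pentagon_solution :: "'t set \<Rightarrow> ('t \<times> 't \<Rightarrow> 't \<times> 't) \<Rightarrow> bool" where
  "reversed_pentagon_solution T s \<longleftrightarrow> s \<in> T \<times> T \<rightarrow> T \<times> T \<and>
     (\<forall>t \<in> T \<times> T \<times> T. (leg12 s \<circ> leg13 s \<circ> leg23 s) t = (leg23 s \<circ> leg12 s) t)"


section \<open>Right actions by automorphisms and the semidirect product\<close>

definition right_action_by_automorphisms ::
    "('a, 'm) monoid_scheme \<Rightarrow> ('n, 'q) monoid_scheme \<Rightarrow> ('a \<Rightarrow> 'n \<Rightarrow> 'a) \<Rightarrow> bool" where
  "right_action_by_automorphisms A N act \<longleftrightarrow>
     (\<forall>u\<in>carrier N. (\<lambda>a. act a u) \<in> iso A A) \<and>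
     (\<forall>a\<in>carrier A. act a \<one>\<^bsub>N\<^esub> = a) \<and>
     (\<forall>a\<in>carrier A. \<forall>u\<in>carrier N. \<forall>v\<in>carrier N. act (act a u) v = act a (u \<otimes>\<^bsub>N\<^esub> v))"

text \<open>The pair \<open>(a, u)\<close> stands for the product \<open>a u\<close>. The multiplication is forced by
  \<open>u b = (u b u\<^sup>-\<^sup>1) u = (act b u\<^sup>-\<^sup>1) u\<close>.\<close>

definition semidirect ::
    "('a, 'm) monoid_scheme \<Rightarrow> ('n, 'q) monoid_scheme \<Rightarrow> ('a \<Rightarrow> 'n \<Rightarrow> 'a) \<Rightarrow> ('a \<times> 'n) monoid" where
  "semidirect A N act =
     \<lparr>carrier = carrier A \<times> carrier N,
      monoid.mult = (\<lambda>(a, u) (b, v). (a \<otimes>\<^bsub>A\<^esub> act b (inv\<^bsub>N\<^esub> u), u \<otimes>\<^bsub>N\<^esub> v)),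
      one = (\<one>\<^bsub>A\<^esub>, \<one>\<^bsub>N\<^esub>)\<rparr>"

context
  fixes A :: "('a, 'm) monoid_scheme" and N :: "('n, 'q) monoid_scheme"
    and act :: "'a \<Rightarrow> 'n \<Rightarrow> 'a"
  assumes A: "comm_group A" and N: "group N" and act: "right_action_by_automorphisms A N act"
begin

interpretation A: comm_group A by (rule A)
interpretation N: group N by (rule N)

lemma act_closed: "a \<in> carrier A \<Longrightarrow> u \<in> carrier N \<Longrightarrow> act a u \<in> carrier A"
  using act by (auto simp: right_action_by_automorphisms_def iso_def hom_def)

lemma act_mult:
  "a \<in> carrier A \<Longrightarrow> b \<in> carrier A \<Longrightarrow> u \<in> carrier N \<Longrightarrow> act (a \<otimes>\<^bsub>A\<^esub> b) u = act a u \<otimes>\<^bsub>A\<^esub> act b u"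
  using act by (auto simp: right_action_by_automorphisms_def iso_def hom_def)

lemma act_1: "a \<in> carrier A \<Longrightarrow> act a \<one>\<^bsub>N\<^esub> = a"
  using act by (auto simp: right_action_by_automorphisms_def)

lemma act_act:
  "a \<in> carrier A \<Longrightarrow> u \<in> carrier N \<Longrightarrow> v \<in> carrier N \<Longrightarrow> act (act a u) v = act a (u \<otimes>\<^bsub>N\<^esub> v)"
  using act by (auto simp: right_action_by_automorphisms_def)

lemma act_one: "u \<in> carrier N \<Longrightarrow> act \<one>\<^bsub>A\<^esub> u = \<one>\<^bsub>A\<^esub>"
  by (metis A.one_closed A.r_one A.r_cancel_one act_closed act_mult)

lemma group_semidirect: "group (semidirect A N act)"
proof (rule groupI)
  fix x assume "x \<in> carrier (semidirect A N act)"
  then obtain a u where x: "x = (a, u)" "a \<in> carrier A" "u \<in> carrier N"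
    by (auto simp: semidirect_def)
  show "\<exists>y\<in>carrier (semidirect A N act). y \<otimes>\<^bsub>semidirect A N act\<^esub> x = \<one>\<^bsub>semidirect A N act\<^esub>"
    by (rule bexI[of _ "(act (inv\<^bsub>A\<^esub> a) u, inv\<^bsub>N\<^esub> u)"])
      (use x in \<open>auto simp: semidirect_def act_closed act_one simp flip: act_mult\<close>)
qed (auto simp: semidirect_def act_closed act_1 act_one act_mult act_act A.m_assoc N.m_assoc
      N.inv_mult_group)

lemma conj_semidirect:
  assumes "a \<in> carrier A" "u \<in> carrier N"
  shows "(\<one>\<^bsub>A\<^esub>, u) \<otimes>\<^bsub>semidirect A N act\<^esub> (a, \<one>\<^bsub>N\<^esub>) \<otimes>\<^bsub>semidirect A N act\<^esub>
     inv\<^bsub>semidirect A N act\<^esub> (\<one>\<^bsub>A\<^esub>, u) = (act a (inv\<^bsub>N\<^esub> u), \<one>\<^bsub>N\<^esub>)"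
proof -
  interpret G: group "semidirect A N act" by (rule group_semidirect)
  have "inv\<^bsub>semidirect A N act\<^esub> (\<one>\<^bsub>A\<^esub>, u) = (\<one>\<^bsub>A\<^esub>, inv\<^bsub>N\<^esub> u)"
    by (rule G.inv_equality) (use assms in \<open>auto simp: semidirect_def act_one\<close>)
  then show ?thesis using assms by (simp add: semidirect_def act_one act_closed)
qed

end


section \<open>Characters\<close>

text \<open>Characters are taken to be extensional, so that equality of elements of the carrier is
  equality of homomorphisms.\<close>

definition char_group :: "('a, 'm) monoid_scheme \<Rightarrow> ('a \<Rightarrow> 'k::field) monoid" where
  "char_group A =
     \<lparr>carrier = hom A (mult_of ring_of_type_algebra) \<inter> extensional (carrier A),
      monoid.mult = (\<lambda>\<chi> \<psi>. \<lambda>a\<in>carrier A. \<chi> a * \<psi> a),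
      one = (\<lambda>a\<in>carrier A. 1)\<rparr>"

definition char_act ::
    "('a, 'm) monoid_scheme \<Rightarrow> ('a \<Rightarrow> 'n \<Rightarrow> 'a) \<Rightarrow> 'n \<Rightarrow> ('a \<Rightarrow> 'k::field) \<Rightarrow> ('a \<Rightarrow> 'k)" where
  "char_act A act u \<chi> = (\<lambda>a\<in>carrier A. \<chi> (act a u))"

lemma char_group_carrier_iff:
  "\<chi> \<in> carrier (char_group A) \<longleftrightarrow>
     \<chi> \<in> extensional (carrier A) \<and> (\<forall>a\<in>carrier A. \<chi> a \<noteq> 0) \<and>
     (\<forall>a\<in>carrier A. \<forall>b\<in>carrier A. \<chi> (a \<otimes>\<^bsub>A\<^esub> b) = \<chi> a * \<chi> b)"
  by (auto simp: char_group_def hom_def ring_of_type_algebra_def)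

lemma comm_group_char_group:
  assumes "group A"
  shows "comm_group (char_group A :: ('a \<Rightarrow> 'k::field) monoid)"
proof (rule comm_groupI)
  interpret A: group A by (rule assms)
  fix \<chi> :: "'a \<Rightarrow> 'k" assume \<chi>: "\<chi> \<in> carrier (char_group A)"
  show "\<exists>\<psi>\<in>carrier (char_group A). \<psi> \<otimes>\<^bsub>char_group A\<^esub> \<chi> = \<one>\<^bsub>char_group A\<^esub>"
    by (rule bexI[of _ "\<lambda>a\<in>carrier A. inverse (\<chi> a)"])
      (use \<chi> in \<open>auto simp: char_group_carrier_iff\<close>,
       use \<chi> in \<open>auto simp: char_group_carrier_iff char_group_def intro!: restrict_ext\<close>)
next
  interpret A: group A by (rule assms)
  fix \<chi> \<psi> :: "'a \<Rightarrow> 'k"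
  assume "\<chi> \<in> carrier (char_group A)" "\<psi> \<in> carrier (char_group A)"
  then have "(\<lambda>a\<in>carrier A. \<chi> a * \<psi> a) \<in> carrier (char_group A)"
    by (auto simp: char_group_carrier_iff)
  then show "\<chi> \<otimes>\<^bsub>char_group A\<^esub> \<psi> \<in> carrier (char_group A)"
    by (simp add: char_group_def)
next
  interpret A: group A by (rule assms)
  have "(\<lambda>a\<in>carrier A. 1 :: 'k) \<in> carrier (char_group A)"
    by (auto simp: char_group_carrier_iff)
  then show "\<one>\<^bsub>char_group A\<^esub> \<in> carrier (char_group A :: ('a \<Rightarrow> 'k) monoid)"
    by (simp add: char_group_def)
qed (auto simp: char_group_def extensional_def fun_eq_iff)

context
  fixes A :: "('a, 'm) monoid_scheme" and N :: "('n, 'q) monoid_scheme"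
    and act :: "'a \<Rightarrow> 'n \<Rightarrow> 'a"
  assumes A: "comm_group A" and N: "group N" and act: "right_action_by_automorphisms A N act"
begin

interpretation A: comm_group A by (rule A)
interpretation N: group N by (rule N)

lemma char_act_closed:
  assumes "\<chi> \<in> carrier (char_group A)" "u \<in> carrier N"
  shows "char_act A act u \<chi> \<in> carrier (char_group A)"
  using assms
  by (auto simp: char_group_carrier_iff char_act_def act_closed[OF A N act] act_mult[OF A N act])

lemma char_act_one:
  assumes "\<chi> \<in> carrier (char_group A)"
  shows "char_act A act \<one>\<^bsub>N\<^esub> \<chi> = \<chi>"
  using assms
  by (auto simp: char_group_carrier_iff char_act_def act_1[OF A N act] extensional_def fun_eq_iff)

lemma char_act_char_act:
  assumes "u \<in> carrier N" "v \<in> carrier N"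
  shows "char_act A act u (char_act A act v \<chi>) = char_act A act (u \<otimes>\<^bsub>N\<^esub> v) \<chi>"
  using assms
  by (auto simp: char_act_def act_closed[OF A N act] act_act[OF A N act] fun_eq_iff)

lemma char_act_conj:
  assumes "a \<in> carrier A" "u \<in> carrier N"
  shows "char_act A act u \<chi> a =
    \<chi> (fst (inv\<^bsub>semidirect A N act\<^esub> (\<one>\<^bsub>A\<^esub>, u) \<otimes>\<^bsub>semidirect A N act\<^esub>
       (a, \<one>\<^bsub>N\<^esub>) \<otimes>\<^bsub>semidirect A N act\<^esub> (\<one>\<^bsub>A\<^esub>, u)))"
proof -
  interpret G: group "semidirect A N act" by (rule group_semidirect[OF A N act])
  have "inv\<^bsub>semidirect A N act\<^esub> (\<one>\<^bsub>A\<^esub>, u) = (\<one>\<^bsub>A\<^esub>, inv\<^bsub>N\<^esub> u)"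
    by (rule G.inv_equality) (use assms in \<open>auto simp: semidirect_def act_one[OF A N act]\<close>)
  then show ?thesis using assms
    by (simp add: char_act_def semidirect_def act_one[OF A N act] act_closed[OF A N act])
qed

end

definition char_idem :: "('a, 'm) monoid_scheme \<Rightarrow> ('a \<Rightarrow> 'k::field) \<Rightarrow> ('a \<Rightarrow>\<^sub>0 'k)" where
  "char_idem A \<chi> = pm_scale (1 / of_nat (card (carrier A)))
     (\<Sum>a\<in>carrier A. pm_scale (\<chi> (inv\<^bsub>A\<^esub> a)) (Poly_Mapping.single a 1))"

text \<open>The element \<open>e\<^sub>\<chi> u\<close>: the image of \<open>e\<^sub>\<chi>\<close> under the inclusion of \<open>k[A]\<close> in \<open>k[G]\<close>, times \<open>u\<close>.\<close>

definition char_basis_elem ::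
    "('a, 'm) monoid_scheme \<Rightarrow> ('n, 'q) monoid_scheme \<Rightarrow> ('a \<Rightarrow> 'n \<Rightarrow> 'a) \<Rightarrow>
     ('a \<Rightarrow> 'k::field) \<times> 'n \<Rightarrow> ('a \<times> 'n \<Rightarrow>\<^sub>0 'k)" where
  "char_basis_elem A N act = (\<lambda>(\<chi>, u).
     ga_mult (semidirect A N act)
       (lin_ext (\<lambda>a. Poly_Mapping.single (a, \<one>\<^bsub>N\<^esub>) 1) (char_idem A \<chi>))
       (Poly_Mapping.single (\<one>\<^bsub>A\<^esub>, u) 1))"

definition char_basis ::
    "('a, 'm) monoid_scheme \<Rightarrow> ('n, 'q) monoid_scheme \<Rightarrow> ('a \<Rightarrow> 'n \<Rightarrow> 'a) \<Rightarrow>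
     ('a \<times> 'n \<Rightarrow>\<^sub>0 'k::field) set" where
  "char_basis A N act = {char_basis_elem A N act (\<chi>, u) |\<chi> u. \<chi> \<in> carrier (char_group A) \<and> u \<in> carrier N}"

definition phi ::
    "('a, 'm) monoid_scheme \<Rightarrow> ('n, 'q) monoid_scheme \<Rightarrow> ('a \<Rightarrow> 'n \<Rightarrow> 'a) \<Rightarrow>
     (('a \<Rightarrow> 'k::field) \<times> 'n) \<times> (('a \<Rightarrow> 'k) \<times> 'n) \<Rightarrow> (('a \<Rightarrow> 'k) \<times> 'n) \<times> (('a \<Rightarrow> 'k) \<times> 'n)" where
  "phi A N act = (\<lambda>((\<alpha>, u), (\<beta>, v)).
     ((\<alpha> \<otimes>\<^bsub>char_group A\<^esub> inv\<^bsub>char_group A\<^esub> (char_act A act u \<beta>), u),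
      (char_act A act u \<beta>, u \<otimes>\<^bsub>N\<^esub> v)))"

end

theory Submission
  imports Defs
begin

text \<open>Everything is read off from coefficients: \<open>e\<^sub>\<chi> u\<close> takes the value \<open>\<chi>(a\<^sup>-\<^sup>1) / |A|\<close> at \<open>(a, u)\<close>,
  and \<open>\<Phi>\<close> is a change of variables on \<open>G \<times> G\<close>, under which a product of characters remains one.
  Linear independence follows from the orthogonality of characters, and spanning from Fourier
  inversion. The latter needs characters separating the points of \<open>A\<close>: the
  hypotheses on \<open>k\<close> give a nontrivial character on each nontrivial cyclic subgroup, which is
  extended to \<open>A\<close> one generator at a time by choosing suitable roots in \<open>k\<close>.\<close>

section \<open>Extending characters of finite abelian groups\<close>

context comm_group
begin

text \<open>Adjoining \<open>x\<close> to \<open>H\<close> gives the products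
  \<open>h \<otimes> x [^] i\<close>, and such a product is sent to
  \<open>\<chi> h * \<zeta> ^ i\<close>. The compatibility condition on powers of \<open>x\<close>
  lying in \<open>H\<close> is exactly what makes this value independent of the chosen
  representation.\<close>

lemma extend_char_by_element:
  fixes \<chi> :: "'a \<Rightarrow> 'k::field"
  assumes fin: "finite (carrier G)" and H: "subgroup H G"
    and \<chi>: "\<chi> \<in> carrier (char_group (G\<lparr>carrier := H\<rparr>))"
    and x: "x \<in> carrier G" and \<zeta>: "\<zeta> \<noteq> 0"
    and compat: "\<And>i::nat. x [^] i \<in> H \<Longrightarrow> \<chi> (x [^] i) = \<zeta> ^ i"
  obtains K and \<psi> :: "'a \<Rightarrow> 'k" where "subgroup K G" "H \<subseteq> K" "x \<in> K"
    "\<psi> \<in> carrier (char_group (G\<lparr>carrier := K\<rparr>))" "\<And>h. h \<in> H \<Longrightarrow> \<psi> h = \<chi> h" "\<psi> x = \<zeta>"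
proof -
  interpret H: subgroup H G by (rule H)
  have \<chi>_nz: "\<chi> h \<noteq> 0" if "h \<in> H" for h
    using \<chi> that by (simp add: char_group_carrier_iff)
  have \<chi>_mult: "\<chi> (h \<otimes> h') = \<chi> h * \<chi> h'" if "h \<in> H" "h' \<in> H" for h h'
    using \<chi> that by (simp add: char_group_carrier_iff)
  have \<chi>_one: "\<chi> \<one> = 1"
    using \<chi>_mult[of \<one> \<one>] \<chi>_nz[of \<one>] by simp
  \<comment> \<open>Natural exponents suffice: closure under inverses comes from the finiteness of
    the group.\<close>
  define K where "K = {h \<otimes> x [^] i |h (i::nat). h \<in> H}"
  have KI: "h \<otimes> x [^] i \<in> K" if "h \<in> H" for h and i :: nat
    using that by (auto simp: K_def)
  \<comment> \<open>For \<open>i \<le> j\<close>, cancelling \<open>x [^] i\<close> leaves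
    \<open>h = h' \<otimes> x [^] d\<close> with \<open>d = j - i\<close>. Hence
    \<open>x [^] d\<close> lies in \<open>H\<close>, and \<open>compat\<close> gives its
    value.\<close>
  have wd_le: "\<chi> h * \<zeta> ^ i = \<chi> h' * \<zeta> ^ j"
    if "h \<in> H" "h' \<in> H" and eq: "h \<otimes> x [^] i = h' \<otimes> x [^] j" and "i \<le> j" for h h' i j
  proof -
    obtain d where d: "j = i + d" using \<open>i \<le> j\<close> le_Suc_ex by blast
    have "h \<otimes> x [^] i = (h' \<otimes> x [^] d) \<otimes> x [^] i"
      using eq that x by (simp add: d nat_pow_mult[symmetric] m_ac)
    then have h: "h = h' \<otimes> x [^] d" using that x by simp
    then have "x [^] d = inv h' \<otimes> h" using that x by (simp add: inv_solve_left)
    then have mem: "x [^] d \<in> H" using that by simp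
    show ?thesis
      using that \<chi>_mult[OF \<open>h' \<in> H\<close> mem] compat[OF mem] h d by (simp add: power_add)
  qed
  have wd: "\<chi> h * \<zeta> ^ i = \<chi> h' * \<zeta> ^ j"
    if "h \<in> H" "h' \<in> H" "h \<otimes> x [^] i = h' \<otimes> x [^] j" for h h' i j
    using wd_le[of h h' i j] wd_le[of h' h j i] that by (metis nat_le_linear)
  \<comment> \<open>The value is unique by \<open>wd\<close>. Restricting to \<open>K\<close> makes
    the function extensional, as \<open>char_group\<close> demands.\<close>
  define \<psi> where "\<psi> = (\<lambda>y\<in>K. THE c. \<exists>h\<in>H. \<exists>i::nat. y = h \<otimes> x [^] i \<and> c = \<chi> h * \<zeta> ^ i)"
  have \<psi>: "\<psi> (h \<otimes> x [^] i) = \<chi> h * \<zeta> ^ i" if "h \<in> H" for h and i :: nat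
    unfolding \<psi>_def using that KI[OF that, of i] by (auto intro!: the_equality wd)
  have K_mult: "(h \<otimes> x [^] i) \<otimes> (h' \<otimes> x [^] j) = (h \<otimes> h') \<otimes> x [^] (i + j)"
    if "h \<in> H" "h' \<in> H" for h h' and i j :: nat
    using that x by (simp add: nat_pow_mult[symmetric] m_ac)
  have K: "subgroup K G"
  proof (rule subgroupI)
    show "K \<subseteq> carrier G" using x by (auto simp: K_def)
    show "K \<noteq> {}" using H.one_closed KI by blast
  next
    fix y assume "y \<in> K"
    then obtain h and i :: nat where y: "y = h \<otimes> x [^] i" "h \<in> H" by (auto simp: K_def)
    have pos: "Coset.order G > 0" using fin by (simp add: order_gt_0_iff_finite)
    \<comment> \<open>With \<open>x\<close> to the power \<open>order G\<close> equal to
      \<open>\<one>\<close>, the exponent \<open>i * (order G - 1)\<close> plays the part of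
      \<open>-i\<close>. The order is positive, so the subtraction does not truncate.\<close>
    have "x [^] i \<otimes> x [^] (i * (Coset.order G - 1)) = x [^] (Coset.order G * i)"
      using x pos by (simp add: nat_pow_mult, cases "Coset.order G") (auto simp: algebra_simps)
    also have "\<dots> = \<one>" using x by (simp add: nat_pow_pow[symmetric] pow_order_eq_1 del: nat_pow_pow)
    finally have "inv (x [^] i) = x [^] (i * (Coset.order G - 1))"
      using x by (metis inv_equality m_comm nat_pow_closed)
    then have "inv y = inv h \<otimes> x [^] (i * (Coset.order G - 1))"
      using y x by (simp add: inv_mult)
    then show "inv y \<in> K" using KI y by simp
  next
    fix y z assume "y \<in> K" "z \<in> K"
    then show "y \<otimes> z \<in> K" by (auto simp: K_def) (metis K_mult H.m_closed)
  qed
  show thesis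
  proof (rule that[OF K])
    show "H \<subseteq> K" using KI[of _ 0] by auto
    show "x \<in> K" using KI[of \<one> 1] x by simp
    show "\<psi> h = \<chi> h" if "h \<in> H" for h using \<psi>[OF that, of 0] that by simp
    show "\<psi> x = \<zeta>" using \<psi>[of \<one> 1] x \<chi>_one by simp
    show "\<psi> \<in> carrier (char_group (G\<lparr>carrier := K\<rparr>))"
      unfolding char_group_carrier_iff
    proof (intro conjI ballI; simp)
      show "\<psi> \<in> extensional K" by (simp add: \<psi>_def)
    next
      fix y assume "y \<in> K"
      then show "\<psi> y \<noteq> 0" using \<psi> \<chi>_nz \<zeta> by (auto simp: K_def)
    next
      fix y z assume "y \<in> K" "z \<in> K"
      then show "\<psi> (y \<otimes> z) = \<psi> y * \<psi> z"
        by (auto simp: K_def) (simp add: K_mult \<psi> \<chi>_mult power_add)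
    qed
  qed
qed

lemma char_pow:
  fixes \<chi> :: "'a \<Rightarrow> 'k::field"
  assumes \<chi>: "\<chi> \<in> carrier (char_group G)" and a: "a \<in> carrier G"
  shows "\<chi> (a [^] (i::nat)) = \<chi> a ^ i"
proof (induction i)
  case 0
  \<comment> \<open>A nonzero idempotent of a field is 1.\<close>
  have "\<chi> \<one> * \<chi> \<one> = \<chi> \<one>" "\<chi> \<one> \<noteq> 0"
    using \<chi> by (metis char_group_carrier_iff one_closed r_one)+
  then show ?case by simp
next
  case (Suc i)
  then show ?case using \<chi> a by (simp add: char_group_carrier_iff)
qed

lemma char_one: "\<chi> \<in> carrier (char_group G) \<Longrightarrow> \<chi> \<one> = 1"
  using char_pow[of \<chi> \<one> 0] by simp

lemma char_inv:
  "\<chi> \<in> carrier (char_group G) \<Longrightarrow> a \<in> carrier G \<Longrightarrow> \<chi> (inv a) = inverse (\<chi> a)"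
proof -
  assume \<chi>: "\<chi> \<in> carrier (char_group G)" and a: "a \<in> carrier G"
  have "\<chi> a * \<chi> (inv a) = \<chi> (a \<otimes> inv a)"
    using \<chi> a unfolding char_group_carrier_iff by (metis inv_closed)
  also have "\<dots> = 1" using a char_one[OF \<chi>] by simp
  finally show ?thesis by (simp add: inverse_unique)
qed

section \<open>Choosing roots in the field and extending characters to the whole group\<close>

text \<open>The exponents that bring \<open>x\<close> into \<open>H\<close> are the multiples of the
  least positive one, \<open>m\<close>, so only the equation
  \<open>\<zeta> ^ m = \<chi> (x [^] m)\<close> has to be solved. A solution exists in the algebraic
  closure; it is a root of unity of order dividing the group order, so it lies in the field.\<close>

lemma exists_compatible_root:
  fixes \<chi> :: "'a \<Rightarrow> 'k::field"
  assumes fin: "finite (carrier G)" and H: "subgroup H G"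
    and roots: "\<forall>\<zeta> :: 'k alg_closure. \<zeta> ^ card (carrier G) = 1 \<longrightarrow> \<zeta> \<in> range to_ac"
    and \<chi>: "\<chi> \<in> carrier (char_group (G\<lparr>carrier := H\<rparr>))"
    and x: "x \<in> carrier G"
  obtains \<zeta> where "\<zeta> \<noteq> 0" "\<And>i::nat. x [^] i \<in> H \<Longrightarrow> \<chi> (x [^] i) = \<zeta> ^ i"
proof -
  interpret H: subgroup H G by (rule H)
  interpret GH: comm_group "G\<lparr>carrier := H\<rparr>" 
    using H by (intro group.group_comm_groupI subgroup_imp_group) (auto intro: m_comm)
  have \<chi>_pow: "\<chi> (h [^] i) = \<chi> h ^ i" if "h \<in> H" for h and i :: nat
    using GH.char_pow[OF \<chi>, of h i] that by (simp add: nat_pow_def)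
  define n where "n = card (carrier G)"
  have n: "n > 0" "x [^] n = \<one>"
    using fin x pow_order_eq_1[OF x] by (auto simp: n_def Coset.order_def card_gt_0_iff)
  \<comment> \<open>The least element exists because the group order \<open>n\<close> is itself such
    an exponent.\<close>
  define m :: nat where "m = (LEAST i. i > 0 \<and> x [^] i \<in> H)"
  have m: "m > 0" "x [^] m \<in> H"
    using LeastI[of "\<lambda>i. i > 0 \<and> x [^] i \<in> H" n] n unfolding m_def by auto
  have m_dvd: "m dvd i" if i: "x [^] i \<in> H" for i :: nat
  proof (rule ccontr)
    assume "\<not> m dvd i"
    \<comment> \<open>Division with remainder: \<open>i mod m\<close> would be a smaller positive
      exponent taking \<open>x\<close> into \<open>H\<close>.\<close>
    then have r: "i mod m > 0" "i mod m < m" using m by (auto simp: dvd_eq_mod_eq_0)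
    have "x [^] i = (x [^] m) [^] (i div m) \<otimes> x [^] (i mod m)"
      using x by (simp add: nat_pow_pow nat_pow_mult)
    then have "x [^] (i mod m) = inv ((x [^] m) [^] (i div m)) \<otimes> x [^] i"
      using x by (simp add: inv_solve_left)
    moreover have "(x [^] m) [^] (i div m) \<in> H"
      using GH.nat_pow_closed[of "x [^] m" "i div m"] m by (simp add: nat_pow_def)
    ultimately have "x [^] (i mod m) \<in> H" using i by simp
    then show False using not_less_Least[of "i mod m" "\<lambda>i. i > 0 \<and> x [^] i \<in> H"] r
      by (simp add: m_def)
  qed
  obtain y :: "'k alg_closure" where y: "y ^ m = to_ac (\<chi> (x [^] m))"
    using nth_root_exists[OF m(1)] by blast
  \<comment> \<open>As \<open>n = m * q\<close>, the \<open>q\<close>-th power of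
    \<open>\<chi> (x [^] m)\<close> is \<open>\<chi> \<one> = 1\<close>. Thus
    \<open>y ^ n = 1\<close>, and \<open>roots\<close> brings \<open>y\<close> down to the
    field.\<close>
  obtain q where q: "n = m * q" using m_dvd[of n] n by auto
  have "(x [^] m) [^] q = \<one>" using n x q by (simp add: nat_pow_pow)
  then have "\<chi> (x [^] m) ^ q = 1"
    using \<chi>_pow[OF m(2), of q] GH.char_one[OF \<chi>] by simp
  then have "y ^ n = 1" by (simp add: q power_mult y flip: to_ac_power)
  then obtain \<zeta> where "y = to_ac \<zeta>" using roots n_def by auto
  with y have \<zeta>: "\<zeta> ^ m = \<chi> (x [^] m)" by (simp flip: to_ac_power)
  show thesis
  proof (rule that[of \<zeta>])
    show "\<zeta> \<noteq> 0" using \<zeta> \<chi> m by (auto simp: char_group_carrier_iff zero_power)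
    show "\<chi> (x [^] i) = \<zeta> ^ i" if i: "x [^] i \<in> H" for i :: nat
    proof -
      obtain d where "i = m * d" using m_dvd[OF i] by auto
      then show ?thesis using \<chi>_pow[OF m(2), of d] x \<zeta> by (simp add: nat_pow_pow power_mult)
    qed
  qed
qed

text \<open>Induction on \<open>card (carrier G) - card H\<close>, which drops whenever an element
  outside \<open>H\<close> is adjoined.\<close>

lemma extend_char:
  fixes \<chi> :: "'a \<Rightarrow> 'k::field"
  assumes fin: "finite (carrier G)"
    and roots: "\<forall>\<zeta> :: 'k alg_closure. \<zeta> ^ card (carrier G) = 1 \<longrightarrow> \<zeta> \<in> range to_ac"
    and "subgroup H G" "\<chi> \<in> carrier (char_group (G\<lparr>carrier := H\<rparr>))"
  obtains \<psi> where "\<psi> \<in> carrier (char_group G)" "\<And>h. h \<in> H \<Longrightarrow> \<psi> h = \<chi> h"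
proof -
  have "\<exists>\<psi>\<in>carrier (char_group G). \<forall>h\<in>H. \<psi> h = \<chi> h"
    using assms(3,4)
  proof (induction "card (carrier G) - card H" arbitrary: H \<chi> rule: less_induct)
    case less
    interpret H: subgroup H G by (rule less)
    show ?case
    proof (cases "H = carrier G")
      case True
      then show ?thesis using less.prems by auto
    next
      case False
      then obtain x where x: "x \<in> carrier G" "x \<notin> H" using H.subset by blast
      obtain \<zeta> where "\<zeta> \<noteq> 0" "\<And>i::nat. x [^] i \<in> H \<Longrightarrow> \<chi> (x [^] i) = \<zeta> ^ i"
        by (metis exists_compatible_root[OF fin less.prems(1) roots less.prems(2) x(1)])
      then obtain K and \<phi> :: "'a \<Rightarrow> 'k" where K: "subgroup K G" "H \<subseteq> K" "x \<in> K"
        "\<phi> \<in> carrier (char_group (G\<lparr>carrier := K\<rparr>))" "\<And>h. h \<in> H \<Longrightarrow> \<phi> h = \<chi> h" "\<phi> x = \<zeta>"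
        by (metis extend_char_by_element[OF fin less.prems x(1)])
      have "finite K" using K(1) fin by (meson finite_subset subgroup.subset)
      then have "card H < card K" using K x by (intro psubset_card_mono) auto
      moreover have "card K \<le> card (carrier G)"
        using K(1) fin by (meson card_mono subgroup.subset)
      ultimately have "card (carrier G) - card K < card (carrier G) - card H" by simp
      from less.hyps[OF this K(1) K(4)] K(2,5) show ?thesis by (metis subset_iff)
    qed
  qed
  then show thesis using that by blast
qed

text \<open>Adjoining \<open>a\<close> to the trivial subgroup with a value
  \<open>\<zeta> \<noteq> 1\<close> whose order divides that of \<open>a\<close> gives a character
  not killing \<open>a\<close>, which then extends to the whole group.\<close>

lemma char_separates:
  assumes fin: "finite (carrier G)"
    and char: "\<not> CHAR('k::field) dvd card (carrier G)"
    and roots: "\<forall>\<zeta> :: 'k alg_closure. \<zeta> ^ card (carrier G) = 1 \<longrightarrow> \<zeta> \<in> range to_ac"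
    and a: "a \<in> carrier G" "a \<noteq> \<one>"
  obtains \<chi> :: "'a \<Rightarrow> 'k::field" where "\<chi> \<in> carrier (char_group G)" "\<chi> a \<noteq> 1"
proof -
  define m where "m = ord a"
  have m: "m > 1"
    using a ord_ge_1[OF fin a(1)] ord_eq_1[OF a(1)] by (auto simp: m_def)
  have m_dvd: "m dvd card (carrier G)"
    using ord_dvd_group_order[OF a(1)] unfolding m_def Coset.order_def .
  \<comment> \<open>No primitive root is required: a root of
    \<open>1 + y + ... + y ^ (m - 1)\<close> satisfies \<open>y ^ m = 1\<close>, and it differs from
    1 because the sum at 1 is \<open>m\<close>, which is nonzero in the field. The degree
    \<open>m - 1\<close> is positive since \<open>m > 1\<close>.\<close>
  obtain y :: "'k alg_closure" where "(\<Sum>k\<le>m - 1. 1 * y ^ k) = 0"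
    using alg_closed[of "m - 1" "\<lambda>_. 1"] m by auto
  moreover have "{..m - 1} = {..<m}" using m by auto
  ultimately have y: "(\<Sum>k<m. y ^ k) = 0" by simp
  have "y ^ m = 1" using power_diff_1_eq[of y m] y by simp
  then have "y ^ card (carrier G) = 1" using m_dvd by (auto simp: power_mult)
  then obtain \<zeta> where \<zeta>: "y = to_ac \<zeta>" using roots by auto
  have \<zeta>m: "\<zeta> ^ m = 1" using \<open>y ^ m = 1\<close> \<zeta> by (simp flip: to_ac_power)
  have "\<zeta> \<noteq> 1"
  proof
    assume "\<zeta> = 1"
    then have "to_ac (of_nat m :: 'k) = 0" using y \<zeta> by simp
    then have "CHAR('k) dvd m" by (simp add: of_nat_eq_0_iff_char_dvd del: to_ac_of_nat)
    then show False using char m_dvd by (meson dvd_trans)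
  qed
  let ?\<epsilon> = "\<lambda>x\<in>{\<one>}. 1 :: 'k"
  have triv: "?\<epsilon> \<in> carrier (char_group (G\<lparr>carrier := {\<one>}\<rparr>))"
    by (auto simp: char_group_carrier_iff)
  have sub: "subgroup {\<one>} G" by (rule triv_subgroup)
  \<comment> \<open>A power \<open>a [^] i\<close> is trivial only if \<open>m\<close> divides
    \<open>i\<close>, and then \<open>\<zeta> ^ i = 1\<close>.\<close>
  have "?\<epsilon> (a [^] i) = \<zeta> ^ i" if "a [^] i \<in> {\<one>}" for i :: nat
    using that a pow_eq_id[OF a(1), of i] \<zeta>m by (auto simp: m_def power_mult)
  moreover have "\<zeta> \<noteq> 0" using \<zeta>m m by (auto simp: zero_power)
  ultimately obtain K and \<phi> :: "'a \<Rightarrow> 'k" where K: "subgroup K G" "{\<one>} \<subseteq> K" "a \<in> K"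
    "\<phi> \<in> carrier (char_group (G\<lparr>carrier := K\<rparr>))" "\<And>h. h \<in> {\<one>} \<Longrightarrow> \<phi> h = ?\<epsilon> h" "\<phi> a = \<zeta>"
    by (metis extend_char_by_element[OF fin sub triv a(1)])
  obtain \<psi> where "\<psi> \<in> carrier (char_group G)" "\<And>h. h \<in> K \<Longrightarrow> \<psi> h = \<phi> h"
    by (metis extend_char[OF fin roots K(1,4)])
  then show thesis using that K(3,6) \<open>\<zeta> \<noteq> 1\<close> by metis
qed

section \<open>Finiteness of the dual group and orthogonality of characters\<close>

text \<open>All values are roots of \<open>X ^ n - 1\<close>, with \<open>n\<close> the group order,
  and a field contains finitely many of these. Being extensional, the characters sit inside a finite
  product set.\<close>

lemma finite_char_group:
  assumes fin: "finite (carrier G)"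
  shows "finite (carrier (char_group G :: ('a \<Rightarrow> 'k::field) monoid))"
proof (rule finite_subset)
  let ?n = "card (carrier G)"
  let ?p = "Polynomial.monom 1 ?n - 1 :: 'k poly"
  have "?n > 0" using fin by (auto simp: card_gt_0_iff)
  then have "poly ?p 0 \<noteq> 0" by (simp add: poly_monom zero_power)
  then have "?p \<noteq> 0" by auto
  then show "finite (PiE (carrier G) (\<lambda>_. {z. poly ?p z = 0}))"
    by (intro finite_PiE fin poly_roots_finite)
  show "carrier (char_group G) \<subseteq> PiE (carrier G) (\<lambda>_. {z. poly ?p z = 0})"
  proof
    fix \<chi> :: "'a \<Rightarrow> 'k" assume \<chi>: "\<chi> \<in> carrier (char_group G)"
    have "\<chi> a ^ ?n = 1" if "a \<in> carrier G" for a
      using char_pow[OF \<chi> that, of ?n] pow_order_eq_1[OF that] char_one[OF \<chi>]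
      by (simp add: Coset.order_def)
    then show "\<chi> \<in> PiE (carrier G) (\<lambda>_. {z. poly ?p z = 0})"
      using \<chi> by (auto simp: poly_monom char_group_carrier_iff extensional_def)
  qed
qed

text \<open>If \<open>\<chi> b \<noteq> 1\<close>, translating the summation index by
  \<open>b\<close> multiplies the sum by \<open>\<chi> b\<close>, so the sum vanishes.\<close>

lemma sum_char:
  fixes \<chi> :: "'a \<Rightarrow> 'k::field"
  assumes \<chi>: "\<chi> \<in> carrier (char_group G)"
  shows "(\<Sum>a\<in>carrier G. \<chi> a) = (if \<chi> = \<one>\<^bsub>char_group G\<^esub> then of_nat (card (carrier G)) else 0)"
proof (cases "\<chi> = \<one>\<^bsub>char_group G\<^esub>")
  case True
  then show ?thesis by (simp add: char_group_def)
next
  case False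
  then obtain b where b: "b \<in> carrier G" "\<chi> b \<noteq> 1"
  proof -
    have "\<chi> = \<one>\<^bsub>char_group G\<^esub>" if "\<forall>b\<in>carrier G. \<chi> b = 1"
      using \<chi> that by (auto simp: char_group_def extensional_def fun_eq_iff)
    then show thesis using False that by blast
  qed
  have "(\<Sum>a\<in>carrier G. \<chi> a) = (\<Sum>a\<in>carrier G. \<chi> (b \<otimes> a))"
    by (rule sum.reindex_bij_witness[of _ "\<lambda>a. b \<otimes> a" "\<lambda>a. inv b \<otimes> a"])
      (use b in \<open>auto simp: m_assoc[symmetric]\<close>)
  also have "\<dots> = \<chi> b * (\<Sum>a\<in>carrier G. \<chi> a)"
    using \<chi> b by (simp add: char_group_carrier_iff sum_distrib_left)
  finally show ?thesis using b False by simp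
qed

lemma char_mult_apply:
  "a \<in> carrier G \<Longrightarrow> (\<chi> \<otimes>\<^bsub>char_group G\<^esub> \<psi>) a = \<chi> a * \<psi> a"
  by (simp add: char_group_def)

lemma char_group_inv_apply:
  fixes \<chi> :: "'a \<Rightarrow> 'k::field"
  assumes \<chi>: "\<chi> \<in> carrier (char_group G)" and a: "a \<in> carrier G"
  shows "(inv\<^bsub>char_group G\<^esub> \<chi>) a = inverse (\<chi> a)"
proof -
  interpret X: comm_group "char_group G :: ('a \<Rightarrow> 'k) monoid"
    by (rule comm_group_char_group[OF is_group])
  have "(\<chi> \<otimes>\<^bsub>char_group G\<^esub> inv\<^bsub>char_group G\<^esub> \<chi>) a = (\<one>\<^bsub>char_group G\<^esub> :: 'a \<Rightarrow> 'k) a"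
    using \<chi> by simp
  then have "\<chi> a * (inv\<^bsub>char_group G\<^esub> \<chi>) a = 1"
    using a by (simp add: char_mult_apply) (simp add: char_group_def)
  then show ?thesis by (simp add: inverse_unique)
qed

text \<open>The summand is the character \<open>\<psi>\<close> times the inverse of
  \<open>\<chi>\<close>, which is trivial only when the two agree, so \<open>sum_char\<close>
  applies.\<close>

lemma char_orthogonality:
  fixes \<chi> \<psi> :: "'a \<Rightarrow> 'k::field"
  assumes \<chi>: "\<chi> \<in> carrier (char_group G)" and \<psi>: "\<psi> \<in> carrier (char_group G)"
  shows "(\<Sum>a\<in>carrier G. \<psi> a * \<chi> (inv a)) = (if \<chi> = \<psi> then of_nat (card (carrier G)) else 0)"
proof -
  interpret X: comm_group "char_group G :: ('a \<Rightarrow> 'k) monoid"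
    by (rule comm_group_char_group[OF is_group])
  let ?\<theta> = "\<psi> \<otimes>\<^bsub>char_group G\<^esub> inv\<^bsub>char_group G\<^esub> \<chi>"
  have "(\<Sum>a\<in>carrier G. \<psi> a * \<chi> (inv a)) = (\<Sum>a\<in>carrier G. ?\<theta> a)"
    by (rule sum.cong) (auto simp: char_mult_apply char_group_inv_apply[OF \<chi>] char_inv[OF \<chi>])
  also have "\<dots> = (if ?\<theta> = \<one>\<^bsub>char_group G\<^esub> then of_nat (card (carrier G)) else 0)"
    using \<chi> \<psi> by (intro sum_char) auto
  also have "?\<theta> = \<one>\<^bsub>char_group G\<^esub> \<longleftrightarrow> \<chi> = \<psi>"
    using X.inv_solve_right'[OF X.one_closed \<psi> \<chi>] \<chi> by (auto simp: eq_commute)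
  finally show ?thesis .
qed

text \<open>The value at \<open>\<one>\<close>, i.e. the number of characters, comes from summing \<open>\<chi> a\<close>
  over all \<open>\<chi>\<close> and \<open>a\<close> in the two possible orders.\<close>

lemma sum_over_char_group:
  assumes fin: "finite (carrier G)"
    and char: "\<not> CHAR('k::field) dvd card (carrier G)"
    and roots: "\<forall>\<zeta> :: 'k alg_closure. \<zeta> ^ card (carrier G) = 1 \<longrightarrow> \<zeta> \<in> range to_ac"
    and a: "a \<in> carrier G"
  shows "(\<Sum>\<chi>\<in>carrier (char_group G). \<chi> a) =
    (if a = \<one> then of_nat (card (carrier G)) else 0 :: 'k)"
proof -
  let ?X = "char_group G :: ('a \<Rightarrow> 'k) monoid"
  interpret X: comm_group ?X by (rule comm_group_char_group[OF is_group])
  note finX = finite_char_group[OF fin, where 'k = 'k]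
  \<comment> \<open>Dual form of the translation argument: multiplication by a \<open>\<psi>\<close>
    with \<open>\<psi> b \<noteq> 1\<close> permutes the characters.\<close>
  have off: "(\<Sum>\<chi>\<in>carrier ?X. \<chi> b) = 0" if b: "b \<in> carrier G" "b \<noteq> \<one>" for b
  proof -
    obtain \<psi> :: "'a \<Rightarrow> 'k" where \<psi>: "\<psi> \<in> carrier ?X" "\<psi> b \<noteq> 1"
      using char_separates[OF fin char roots b] by blast
    have "(\<Sum>\<chi>\<in>carrier ?X. \<chi> b) = (\<Sum>\<chi>\<in>carrier ?X. (\<psi> \<otimes>\<^bsub>?X\<^esub> \<chi>) b)"
      by (rule sum.reindex_bij_witness[of _ "\<lambda>\<chi>. \<psi> \<otimes>\<^bsub>?X\<^esub> \<chi>" "\<lambda>\<chi>. inv\<^bsub>?X\<^esub> \<psi> \<otimes>\<^bsub>?X\<^esub> \<chi>"])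
        (use \<psi> in \<open>auto simp: X.m_assoc[symmetric]\<close>)
    also have "\<dots> = \<psi> b * (\<Sum>\<chi>\<in>carrier ?X. \<chi> b)"
      using b by (simp add: char_mult_apply sum_distrib_left)
    finally show ?thesis using \<psi> by simp
  qed
  have "(of_nat (card (carrier G)) :: 'k) = (\<Sum>\<chi>\<in>carrier ?X. \<Sum>b\<in>carrier G. \<chi> b)"
    using finX by (simp add: sum_char sum.delta)
  also have "\<dots> = (\<Sum>b\<in>carrier G. if b = \<one> then (\<Sum>\<chi>\<in>carrier ?X. \<chi> \<one>) else 0)"
    by (subst sum.swap) (auto intro!: sum.cong simp: off)
  also have "\<dots> = (\<Sum>\<chi>\<in>carrier ?X. \<chi> \<one>)" using fin by (simp add: sum.delta)
  finally show ?thesis using off a by auto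
qed

end

section \<open>The map \<open>\<Phi>\<close> on the idempotent basis\<close>

text \<open>On \<open>carrier G \<times> carrier G\<close> the map taking \<open>(g, h)\<close> to
  \<open>(g, g \<otimes> h)\<close> is a bijection with inverse
  \<open>(g, inv g \<otimes> h)\<close>, so at most one key contributes to each coefficient.\<close>

lemma lookup_Phi:
  fixes G :: "('g, 'm) monoid_scheme" (structure)
  assumes "group G" and keys: "Poly_Mapping.keys z \<subseteq> carrier G \<times> carrier G"
  shows "Poly_Mapping.lookup (Phi G z) (g, h) =
    (if g \<in> carrier G \<and> h \<in> carrier G then Poly_Mapping.lookup z (g, inv g \<otimes> h) else 0)"
proof -
  interpret group G by fact
  have "Poly_Mapping.lookup (Phi G z) (g, h) =
      (\<Sum>p\<in>Poly_Mapping.keys z. if p = (g, inv g \<otimes> h) \<and> g \<in> carrier G \<and> h \<in> carrier G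
        then Poly_Mapping.lookup z p else 0)"
    unfolding Phi_def lin_ext_def lookup_sum
  proof (rule sum.cong)
    fix p assume "p \<in> Poly_Mapping.keys z"
    then obtain g' h' where p: "p = (g', h')" "g' \<in> carrier G" "h' \<in> carrier G"
      using keys by (cases p) auto
    have "g' \<otimes> h' = h \<longleftrightarrow> h' = inv g' \<otimes> h \<and> h \<in> carrier G"
      using p inv_solve_left[of h' g' h] m_closed by auto
    then show "Poly_Mapping.lookup (pm_scale (Poly_Mapping.lookup z p)
        (case p of (g, h) \<Rightarrow> Poly_Mapping.single (g, g \<otimes> h) 1)) (g, h) =
      (if p = (g, inv g \<otimes> h) \<and> g \<in> carrier G \<and> h \<in> carrier G
        then Poly_Mapping.lookup z p else 0)"
      using p by (auto simp: lookup_single when_def)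
  qed simp
  also have "\<dots> = (if g \<in> carrier G \<and> h \<in> carrier G
      then Poly_Mapping.lookup z (g, inv g \<otimes> h) else 0)"
    by (cases "g \<in> carrier G \<and> h \<in> carrier G") (auto simp: sum.delta in_keys_iff)
  finally show ?thesis .
qed

section \<open>Coefficients in the semidirect product and the formula for \<open>Phi\<close>\<close>

locale abelian_semidirect = A: comm_group A + N: group N
  for A :: "('a, 'm) monoid_scheme" and N :: "('n, 'q) monoid_scheme" +
  fixes act :: "'a \<Rightarrow> 'n \<Rightarrow> 'a"
  assumes act: "right_action_by_automorphisms A N act"
    and fin: "finite (carrier A)"
begin

lemmas act_facts = act_closed[OF A.comm_group_axioms N.group_axioms act]
  act_mult[OF A.comm_group_axioms N.group_axioms act]
  act_1[OF A.comm_group_axioms N.group_axioms act]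
  act_act[OF A.comm_group_axioms N.group_axioms act]
  act_one[OF A.comm_group_axioms N.group_axioms act]

lemmas char_act_facts = char_act_closed[OF A.comm_group_axioms N.group_axioms act]
  char_act_char_act[OF A.comm_group_axioms N.group_axioms act]

lemma carrier_semidirect: "carrier (semidirect A N act) = carrier A \<times> carrier N"
  by (simp add: semidirect_def)

lemma mult_semidirect:
  "(a, u) \<otimes>\<^bsub>semidirect A N act\<^esub> (b, v) = (a \<otimes>\<^bsub>A\<^esub> act b (inv\<^bsub>N\<^esub> u), u \<otimes>\<^bsub>N\<^esub> v)"
  by (simp add: semidirect_def)

lemma group_G: "group (semidirect A N act)"
  by (rule group_semidirect[OF A.comm_group_axioms N.group_axioms act])

lemma inv_semidirect:
  assumes "a \<in> carrier A" "u \<in> carrier N"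
  shows "inv\<^bsub>semidirect A N act\<^esub> (a, u) = (act (inv\<^bsub>A\<^esub> a) u, inv\<^bsub>N\<^esub> u)"
proof (rule group.inv_equality[OF group_G])
  show "(act (inv\<^bsub>A\<^esub> a) u, inv\<^bsub>N\<^esub> u) \<otimes>\<^bsub>semidirect A N act\<^esub> (a, u) = \<one>\<^bsub>semidirect A N act\<^esub>"
    using assms by (simp add: semidirect_def act_facts flip: act_facts(2))
qed (use assms in \<open>auto simp: carrier_semidirect act_facts\<close>)

text \<open>Since \<open>(a, \<one>)\<close> times \<open>(\<one>, u)\<close> is
  \<open>(a, u)\<close>, the element is a translate of the idempotent, supported on the coset of
  \<open>A\<close> belonging to \<open>u\<close>.\<close>

lemma lookup_char_basis_elem:
  assumes "u \<in> carrier N"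
  shows "Poly_Mapping.lookup (char_basis_elem A N act (\<chi>, u)) (a, v) =
    (if a \<in> carrier A \<and> v = u then \<chi> (inv\<^bsub>A\<^esub> a) / of_nat (card (carrier A)) else 0)"
proof -
  have "char_basis_elem A N act (\<chi>, u) = pm_scale (1 / of_nat (card (carrier A)))
     (\<Sum>a\<in>carrier A. pm_scale (\<chi> (inv\<^bsub>A\<^esub> a)) (Poly_Mapping.single (a, u) 1))"
    using assms
    by (simp add: char_basis_elem_def ga_mult_def lin_ext_lin_ext char_idem_def lin_ext_scale
        lin_ext_sum mult_semidirect act_facts cong: sum.cong)
  then show ?thesis
    using fin by (auto simp: lookup_sum lookup_single when_def if_distrib sum.delta cong: if_cong
        intro!: sum.neutral)
qed

lemma keys_char_basis_elem:
  "u \<in> carrier N \<Longrightarrow> Poly_Mapping.keys (char_basis_elem A N act (\<chi>, u)) \<subseteq> carrier A \<times> carrier N"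
  by (auto simp: in_keys_iff lookup_char_basis_elem split: if_splits)

lemma keys_tensor_char_basis_elem:
  assumes "u \<in> carrier N" "v \<in> carrier N"
  shows "Poly_Mapping.keys (tensor (char_basis_elem A N act (\<alpha>, u)) (char_basis_elem A N act (\<beta>, v)))
    \<subseteq> carrier (semidirect A N act) \<times> carrier (semidirect A N act)"
  using assms
  by (auto simp: in_keys_iff lookup_tensor lookup_char_basis_elem carrier_semidirect split: if_splits)

text \<open>Write \<open>\<gamma>\<close> for \<open>char_act A act u \<beta>\<close>. By
  \<open>lookup_Phi\<close> the coefficient at \<open>((a, u), (c, u v))\<close> is, up to the
  factor \<open>1/|A|^2\<close>, \<open>\<alpha>(inv a)\<close> times
  \<open>\<gamma>(a) \<gamma>(inv c)\<close>. Moving \<open>\<gamma>(a)\<close> to the first factor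
  turns \<open>\<alpha>\<close> into its quotient by \<open>\<gamma>\<close>.\<close>

lemma Phi_char_basis_elem:
  fixes \<alpha> \<beta> :: "'a \<Rightarrow> 'k::field"
  assumes \<alpha>: "\<alpha> \<in> carrier (char_group A)" and \<beta>: "\<beta> \<in> carrier (char_group A)"
    and u: "u \<in> carrier N" and v: "v \<in> carrier N"
  shows "Phi (semidirect A N act)
      (tensor (char_basis_elem A N act (\<alpha>, u)) (char_basis_elem A N act (\<beta>, v))) =
    tensor (char_basis_elem A N act
        (\<alpha> \<otimes>\<^bsub>char_group A\<^esub> inv\<^bsub>char_group A\<^esub> (char_act A act u \<beta>), u))
      (char_basis_elem A N act (char_act A act u \<beta>, u \<otimes>\<^bsub>N\<^esub> v))" (is "Phi ?G ?z = ?w")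
proof (rule poly_mapping_eqI)
  fix p :: "('a \<times> 'n) \<times> 'a \<times> 'n"
  obtain a x c y where p: "p = ((a, x), (c, y))" by (metis prod.exhaust)
  let ?\<gamma> = "char_act A act u \<beta>"
  have \<gamma>: "?\<gamma> \<in> carrier (char_group A)" using char_act_facts(1) \<beta> u by blast
  note keys = keys_tensor_char_basis_elem[OF u v, of \<alpha> \<beta>]
  note Phi = lookup_Phi[OF group_G keys]
  show "Poly_Mapping.lookup (Phi ?G ?z) p = Poly_Mapping.lookup ?w p"
  proof (cases "a \<in> carrier A \<and> c \<in> carrier A \<and> x = u \<and> y = u \<otimes>\<^bsub>N\<^esub> v")
    case True
    then have a: "a \<in> carrier A" and c: "c \<in> carrier A" and xy: "x = u" "y = u \<otimes>\<^bsub>N\<^esub> v"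
      by auto
    \<comment> \<open>The argument of \<open>\<beta>\<close> is the inverse of the first component
      of \<open>inv (a, u) \<otimes> (c, u \<otimes> v)\<close>.\<close>
    have \<beta>_eq: "\<beta> (inv\<^bsub>A\<^esub> (act (inv\<^bsub>A\<^esub> a) u \<otimes>\<^bsub>A\<^esub> act c u)) = ?\<gamma> a * ?\<gamma> (inv\<^bsub>A\<^esub> c)"
    proof -
      have "\<beta> (inv\<^bsub>A\<^esub> (act (inv\<^bsub>A\<^esub> a) u \<otimes>\<^bsub>A\<^esub> act c u)) = inverse (\<beta> (act (inv\<^bsub>A\<^esub> a \<otimes>\<^bsub>A\<^esub> c) u))"
        using a c u by (simp add: A.char_inv[OF \<beta>] act_facts)
      also have "\<dots> = inverse (?\<gamma> (inv\<^bsub>A\<^esub> a \<otimes>\<^bsub>A\<^esub> c))"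
        using a c by (simp add: char_act_def)
      also have "\<dots> = ?\<gamma> a * ?\<gamma> (inv\<^bsub>A\<^esub> c)"
        using a c A.char_inv[OF \<gamma>] \<gamma> by (simp add: char_group_carrier_iff)
      finally show ?thesis .
    qed
    have "inv\<^bsub>N\<^esub> u \<otimes>\<^bsub>N\<^esub> (u \<otimes>\<^bsub>N\<^esub> v) = v"
      using u v by (simp add: N.m_assoc[symmetric])
    then show ?thesis
      using a c u v xy
      by (simp add: p Phi carrier_semidirect inv_semidirect mult_semidirect lookup_tensor
          lookup_char_basis_elem act_facts \<beta>_eq A.char_mult_apply A.char_group_inv_apply[OF \<gamma>]
          A.char_inv[OF \<gamma>] A.char_inv[OF \<alpha>])
  next
    \<comment> \<open>Away from the common support both coefficients vanish; on the left this uses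
      that \<open>inv u \<otimes> y = v\<close> forces \<open>y = u \<otimes> v\<close>.\<close>
    case False
    then have "Poly_Mapping.lookup ?w p = 0"
      using u v by (auto simp: p lookup_tensor lookup_char_basis_elem)
    moreover have "y = u \<otimes>\<^bsub>N\<^esub> v" if "y \<in> carrier N" "inv\<^bsub>N\<^esub> u \<otimes>\<^bsub>N\<^esub> y = v"
      using that u by (auto simp: N.m_assoc[symmetric])
    then have "Poly_Mapping.lookup (Phi ?G ?z) p = 0"
      using False u v
      by (auto simp: p Phi carrier_semidirect inv_semidirect mult_semidirect lookup_tensor
          lookup_char_basis_elem act_facts)
    ultimately show ?thesis by simp
  qed
qed

section \<open>Dual functionals, linear independence and Fourier inversion\<close>

text \<open>The linear functional reading off the coefficient at one basis element. No division by
  the order of \<open>A\<close> occurs, because \<open>char_idem\<close> already carries that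
  factor.\<close>

definition char_coord :: "('a \<Rightarrow> 'k::field) \<times> 'n \<Rightarrow> ('a \<times> 'n \<Rightarrow>\<^sub>0 'k) \<Rightarrow> 'k" where
  "char_coord = (\<lambda>(\<psi>, v) x. \<Sum>a\<in>carrier A. \<psi> a * Poly_Mapping.lookup x (a, v))"

lemma char_coord_char_basis_elem:
  fixes s t :: "('a \<Rightarrow> 'k::field) \<times> 'n"
  assumes char: "\<not> CHAR('k) dvd card (carrier A)"
    and s: "s \<in> carrier (char_group A) \<times> carrier N"
    and t: "t \<in> carrier (char_group A) \<times> carrier N"
  shows "char_coord s (char_basis_elem A N act t) = (if s = t then 1 else 0)"
proof -
  obtain \<psi> v \<chi> u where st: "s = (\<psi>, v)" "t = (\<chi>, u)" by (metis prod.exhaust)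
  have n: "(of_nat (card (carrier A)) :: 'k) \<noteq> 0" using char by (simp add: of_nat_eq_0_iff_char_dvd)
  show ?thesis
  proof (cases "v = u")
    case True
    have "char_coord s (char_basis_elem A N act t) =
        (\<Sum>a\<in>carrier A. \<psi> a * \<chi> (inv\<^bsub>A\<^esub> a)) / of_nat (card (carrier A))"
      using s t True by (simp add: st char_coord_def lookup_char_basis_elem sum_divide_distrib)
    then show ?thesis
      using s t True n A.char_orthogonality[of \<chi> \<psi>] by (auto simp: st)
  next
    case False
    then show ?thesis using t by (simp add: st char_coord_def lookup_char_basis_elem)
  qed
qed

text \<open>The kernel of a linear functional is a subspace.\<close>

lemma char_coord_span:
  assumes "x \<in> pm.span B" and "\<And>b. b \<in> B \<Longrightarrow> char_coord s b = 0"
  shows "char_coord s x = 0"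
  using assms(1)
proof (induction rule: pm.span_induct_alt)
  case base
  then show ?case by (simp add: char_coord_def split: prod.splits)
next
  case (step c b y)
  have "char_coord s (pm_scale c b + y) = c * char_coord s b + char_coord s y"
    by (auto simp: char_coord_def lookup_add algebra_simps sum.distrib sum_distrib_left
        split: prod.splits)
  then show ?case using step assms(2) by simp
qed

lemma char_basis_image:
  "(char_basis A N act :: ('a \<times> 'n \<Rightarrow>\<^sub>0 'k::field) set) =
    char_basis_elem A N act ` (carrier (char_group A) \<times> carrier N)"
  by (auto simp: char_basis_def)

lemma inj_on_char_basis_elem:
  assumes char: "\<not> CHAR('k::field) dvd card (carrier A)"
  shows "inj_on (char_basis_elem A N act :: ('a \<Rightarrow> 'k) \<times> 'n \<Rightarrow> _)
    (carrier (char_group A) \<times> carrier N)"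
  by (rule inj_onI) (metis char_coord_char_basis_elem[OF char] zero_neq_one)

text \<open>A basis element in the span of the others would have own coordinate 0, whereas it is
  1.\<close>

lemma independent_char_basis:
  assumes char: "\<not> CHAR('k::field) dvd card (carrier A)"
  shows "pm.independent (char_basis A N act :: ('a \<times> 'n \<Rightarrow>\<^sub>0 'k) set)"
proof
  let ?B = "char_basis A N act :: ('a \<times> 'n \<Rightarrow>\<^sub>0 'k) set"
  assume "pm.dependent ?B"
  then obtain s :: "('a \<Rightarrow> 'k) \<times> 'n" where s: "s \<in> carrier (char_group A) \<times> carrier N"
    and span: "char_basis_elem A N act s \<in> pm.span (?B - {char_basis_elem A N act s})"
    by (auto simp: pm.dependent_def char_basis_image)
  have "char_coord s (char_basis_elem A N act s) = 0"
    using span by (rule char_coord_span)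
      (auto simp: char_basis_image char_coord_char_basis_elem[OF char s])
  then show False using char_coord_char_basis_elem[OF char s s] by simp
qed

text \<open>Fourier inversion: the coefficient of the right side at \<open>(b, u)\<close> is the
  average of \<open>\<chi> (a \<otimes> inv b)\<close> over all characters, which is 1 for
  \<open>a = b\<close> and 0 otherwise.\<close>

lemma single_eq_sum_char_basis_elem:
  assumes char: "\<not> CHAR('k::field) dvd card (carrier A)"
    and roots: "\<forall>\<zeta> :: 'k alg_closure. \<zeta> ^ card (carrier A) = 1 \<longrightarrow> \<zeta> \<in> range to_ac"
    and a: "a \<in> carrier A" and u: "u \<in> carrier N"
  shows "Poly_Mapping.single (a, u) (1 :: 'k) =
    (\<Sum>\<chi>\<in>carrier (char_group A). pm_scale (\<chi> a) (char_basis_elem A N act (\<chi>, u)))"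
proof (rule poly_mapping_eqI)
  fix p :: "'a \<times> 'n"
  obtain b v where p: "p = (b, v)" by (cases p)
  let ?n = "of_nat (card (carrier A)) :: 'k"
  have n: "?n \<noteq> 0" using char by (simp add: of_nat_eq_0_iff_char_dvd)
  show "Poly_Mapping.lookup (Poly_Mapping.single (a, u) 1) p =
    Poly_Mapping.lookup (\<Sum>\<chi>\<in>carrier (char_group A).
      pm_scale (\<chi> a :: 'k) (char_basis_elem A N act (\<chi>, u))) p"
  proof (cases "b \<in> carrier A \<and> v = u")
    case True
    then have b: "b \<in> carrier A" and "v = u" by auto
    have "a \<otimes>\<^bsub>A\<^esub> inv\<^bsub>A\<^esub> b = \<one>\<^bsub>A\<^esub> \<longleftrightarrow> a = b"
      using a b by (metis A.inv_closed A.inv_equality A.inv_inv A.r_inv)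
    then have "(if a = b then ?n else 0) = (\<Sum>\<chi>\<in>carrier (char_group A). \<chi> (a \<otimes>\<^bsub>A\<^esub> inv\<^bsub>A\<^esub> b))"
      using A.sum_over_char_group[OF fin char roots, of "a \<otimes>\<^bsub>A\<^esub> inv\<^bsub>A\<^esub> b"] a b by simp
    also have "\<dots> = (\<Sum>\<chi>\<in>carrier (char_group A). \<chi> a * \<chi> (inv\<^bsub>A\<^esub> b))"
      using a b by (intro sum.cong) (auto simp: char_group_carrier_iff)
    finally have "(\<Sum>\<chi>\<in>carrier (char_group A). \<chi> a * \<chi> (inv\<^bsub>A\<^esub> b)) / ?n = (if a = b then 1 else 0)"
      using n by (auto split: if_splits)
    then show ?thesis
      using \<open>v = u\<close> u b
      by (simp add: p lookup_sum lookup_single when_def lookup_char_basis_elem sum_divide_distrib)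
  next
    case False
    then show ?thesis
      using a u by (auto simp: p lookup_sum lookup_single when_def lookup_char_basis_elem)
  qed
qed

lemma span_char_basis:
  assumes char: "\<not> CHAR('k::field) dvd card (carrier A)"
    and roots: "\<forall>\<zeta> :: 'k alg_closure. \<zeta> ^ card (carrier A) = 1 \<longrightarrow> \<zeta> \<in> range to_ac"
  shows "pm.span (char_basis A N act :: ('a \<times> 'n \<Rightarrow>\<^sub>0 'k) set) = group_algebra (semidirect A N act)"
proof
  let ?B = "char_basis A N act :: ('a \<times> 'n \<Rightarrow>\<^sub>0 'k) set"
  show "pm.span ?B \<subseteq> group_algebra (semidirect A N act)"
  proof (rule pm.span_minimal)
    show "?B \<subseteq> group_algebra (semidirect A N act)"
      using keys_char_basis_elem
      by (fastforce simp: char_basis_image group_algebra_def carrier_semidirect)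
    show "pm.subspace (group_algebra (semidirect A N act) :: ('a \<times> 'n \<Rightarrow>\<^sub>0 'k) set)"
      by (rule pm.subspaceI)
        (auto simp: group_algebra_def in_keys_iff lookup_add subset_iff, metis add_0)
  qed
  show "group_algebra (semidirect A N act) \<subseteq> pm.span ?B"
  proof
    fix x :: "'a \<times> 'n \<Rightarrow>\<^sub>0 'k" assume "x \<in> group_algebra (semidirect A N act)"
    then have keys: "Poly_Mapping.keys x \<subseteq> carrier A \<times> carrier N"
      by (simp add: group_algebra_def carrier_semidirect)
    have "x = (\<Sum>p\<in>Poly_Mapping.keys x. pm_scale (Poly_Mapping.lookup x p) (Poly_Mapping.single p 1))"
      by (rule poly_mapping_eqI)
        (auto simp: lookup_sum lookup_single when_def if_distrib sum.delta in_keys_iff cong: if_cong)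
    also have "\<dots> \<in> pm.span ?B"
    proof (intro pm.span_sum pm.span_scale)
      fix p assume "p \<in> Poly_Mapping.keys x"
      then obtain a u where p: "p = (a, u)" "a \<in> carrier A" "u \<in> carrier N" using keys by auto
      show "Poly_Mapping.single p 1 \<in> pm.span ?B"
        unfolding p(1) single_eq_sum_char_basis_elem[OF char roots p(2,3)]
        using p by (intro pm.span_sum pm.span_scale pm.span_base) (auto simp: char_basis_image)
    qed
    finally show "x \<in> pm.span ?B" .
  qed
qed

section \<open>The reversed pentagon equation on the dual group\<close>

lemma char_act_mult:
  fixes \<alpha> \<beta> :: "'a \<Rightarrow> 'k::field"
  assumes "u \<in> carrier N"
  shows "char_act A act u (\<alpha> \<otimes>\<^bsub>char_group A\<^esub> \<beta>) =
    char_act A act u \<alpha> \<otimes>\<^bsub>char_group A\<^esub> char_act A act u \<beta>"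
  using assms by (auto simp: char_act_def char_group_def act_facts)

lemma char_act_inv:
  fixes \<beta> :: "'a \<Rightarrow> 'k::field"
  assumes "u \<in> carrier N" and \<beta>: "\<beta> \<in> carrier (char_group A)"
  shows "char_act A act u (inv\<^bsub>char_group A\<^esub> \<beta>) = inv\<^bsub>char_group A\<^esub> (char_act A act u \<beta>)"
proof -
  interpret X: comm_group "char_group A :: ('a \<Rightarrow> 'k) monoid"
    by (rule comm_group_char_group[OF A.is_group])
  have "char_act A act u (inv\<^bsub>char_group A\<^esub> \<beta>) \<otimes>\<^bsub>char_group A\<^esub> char_act A act u \<beta> =
      char_act A act u \<one>\<^bsub>char_group A\<^esub>"
    using assms by (simp flip: char_act_mult)
  also have "\<dots> = \<one>\<^bsub>char_group A\<^esub>"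
    using assms by (auto simp: char_act_def char_group_def act_facts)
  finally show ?thesis
    using assms char_act_facts(1) X.inv_equality X.inv_closed by metis
qed

text \<open>The group acts on characters by automorphisms, so the two sides agree in all components
  by the action laws, except for the first character, which is settled by
  \<open>cancel\<close>.\<close>

lemma reversed_pentagon_phi:
  "reversed_pentagon_solution (carrier (char_group A :: ('a \<Rightarrow> 'k::field) monoid) \<times> carrier N)
    (phi A N act)"
proof -
  let ?X = "char_group A :: ('a \<Rightarrow> 'k) monoid"
  interpret X: comm_group ?X
    by (rule comm_group_char_group[OF A.is_group])
  \<comment> \<open>Used with \<open>\<beta>\<close> and \<open>\<gamma>\<close> replaced by
    \<open>u \<cdot> \<beta>\<close> and \<open>(u v) \<cdot> \<gamma>\<close>: applying
    \<open>leg23\<close> and \<open>leg13\<close> first introduces factors of the latter, which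
    cancel by commutativity.\<close>
  have cancel: "(\<alpha> \<otimes>\<^bsub>?X\<^esub> inv\<^bsub>?X\<^esub> \<gamma>) \<otimes>\<^bsub>?X\<^esub> inv\<^bsub>?X\<^esub> (\<beta> \<otimes>\<^bsub>?X\<^esub> inv\<^bsub>?X\<^esub> \<gamma>) = \<alpha> \<otimes>\<^bsub>?X\<^esub> inv\<^bsub>?X\<^esub> \<beta>"
    if "\<alpha> \<in> carrier ?X" "\<beta> \<in> carrier ?X" "\<gamma> \<in> carrier ?X" for \<alpha> \<beta> \<gamma>
  proof -
    have "inv\<^bsub>?X\<^esub> \<gamma> \<otimes>\<^bsub>?X\<^esub> (\<gamma> \<otimes>\<^bsub>?X\<^esub> inv\<^bsub>?X\<^esub> \<beta>) = inv\<^bsub>?X\<^esub> \<beta>"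
      using that by (simp add: X.m_assoc[symmetric])
    then show ?thesis using that by (simp add: X.inv_mult X.m_ac(1)) (metis X.m_comm X.inv_closed)
  qed
  show ?thesis
    unfolding reversed_pentagon_solution_def
  proof (intro conjI ballI)
    show "phi A N act \<in> (carrier ?X \<times> carrier N) \<times> carrier ?X \<times> carrier N \<rightarrow>
        (carrier ?X \<times> carrier N) \<times> carrier ?X \<times> carrier N"
      by (auto simp: phi_def char_act_facts)
  next
    fix t assume "t \<in> (carrier ?X \<times> carrier N) \<times> (carrier ?X \<times> carrier N) \<times> carrier ?X \<times> carrier N"
    then show "(leg12 (phi A N act) \<circ> leg13 (phi A N act) \<circ> leg23 (phi A N act)) t =
        (leg23 (phi A N act) \<circ> leg12 (phi A N act)) t"
      by (auto simp: leg12_def leg13_def leg23_def phi_def char_act_mult char_act_inv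
          char_act_facts cancel N.m_assoc)
  qed
qed

end

text \<open>The bijection is what allows \<open>(\<chi>, u)\<close> to be identified with its basis
  element. The condition on \<open>alg_closure\<close> says that all roots of unity of order
  dividing \<open>card (carrier A)\<close> already lie in the field.\<close>

theorem proposition4:
  fixes A :: "('a, 'm) monoid_scheme" and N :: "('n, 'q) monoid_scheme"
    and act :: "'a \<Rightarrow> 'n \<Rightarrow> 'a"
  assumes "comm_group A" and "finite (carrier A)" and "group N"
    and "right_action_by_automorphisms A N act"
    and "\<not> CHAR('k::field) dvd card (carrier A)"
    and "\<forall>\<zeta> :: 'k alg_closure. \<zeta> ^ card (carrier A) = 1 \<longrightarrow> \<zeta> \<in> range to_ac"
  shows "Phi_set_theoretic_basis (semidirect A N act) (char_basis A N act :: ('a \<times> 'n \<Rightarrow>\<^sub>0 'k) set) \<and>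
    bij_betw (char_basis_elem A N act)
      (carrier (char_group A :: ('a \<Rightarrow> 'k) monoid) \<times> carrier N) (char_basis A N act) \<and>
    reversed_pentagon_solution (carrier (char_group A :: ('a \<Rightarrow> 'k) monoid) \<times> carrier N)
      (phi A N act) \<and>
    (\<forall>s \<in> carrier (char_group A :: ('a \<Rightarrow> 'k) monoid) \<times> carrier N.
     \<forall>t \<in> carrier (char_group A :: ('a \<Rightarrow> 'k) monoid) \<times> carrier N.
       Phi (semidirect A N act) (tensor (char_basis_elem A N act s) (char_basis_elem A N act t)) =
       tensor (char_basis_elem A N act (fst (phi A N act (s, t))))
              (char_basis_elem A N act (snd (phi A N act (s, t)))))"
proof -
  interpret abelian_semidirect A N act
    using assms by (intro abelian_semidirect.intro abelian_semidirect_axioms.intro)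
  let ?T = "carrier (char_group A :: ('a \<Rightarrow> 'k) monoid) \<times> carrier N"
  have Phi: "Phi (semidirect A N act) (tensor (char_basis_elem A N act s) (char_basis_elem A N act t)) =
      tensor (char_basis_elem A N act (fst (phi A N act (s, t))))
        (char_basis_elem A N act (snd (phi A N act (s, t))))"
    if "s \<in> ?T" "t \<in> ?T" for s t
    using that by (auto simp: phi_def Phi_char_basis_elem)
  have phi: "phi A N act (s, t) \<in> ?T \<times> ?T" if "s \<in> ?T" "t \<in> ?T" for s t
    using reversed_pentagon_phi[where 'k = 'k] that unfolding reversed_pentagon_solution_def by blast
  have "\<exists>b'\<in>char_basis A N act. \<exists>c'\<in>char_basis A N act.
      Phi (semidirect A N act) (tensor b c) = tensor b' c'"
    if bc: "b \<in> char_basis A N act" "c \<in> char_basis A N act" for b c :: "'a \<times> 'n \<Rightarrow>\<^sub>0 'k"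
  proof -
    obtain s t where st: "s \<in> ?T" "t \<in> ?T" "b = char_basis_elem A N act s"
      "c = char_basis_elem A N act t"
      using bc unfolding char_basis_image by blast
    have "fst (phi A N act (s, t)) \<in> ?T" "snd (phi A N act (s, t)) \<in> ?T"
      using phi[OF st(1,2)] by (auto simp: mem_Times_iff)
    then show ?thesis using Phi[OF st(1,2)] unfolding st(3,4) char_basis_image by (metis imageI)
  qed
  then have "Phi_set_theoretic_basis (semidirect A N act) (char_basis A N act :: ('a \<times> 'n \<Rightarrow>\<^sub>0 'k) set)"
    using independent_char_basis[OF assms(5)] span_char_basis[OF assms(5,6)]
    unfolding Phi_set_theoretic_basis_def basis_of_group_algebra_def by blast
  moreover have "bij_betw (char_basis_elem A N act) ?T (char_basis A N act)"
    using inj_on_char_basis_elem[OF assms(5)] unfolding bij_betw_def char_basis_image by blast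
  ultimately show ?thesis using Phi reversed_pentagon_phi by blast
qed

end
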